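(* Let $\mathrm{Ag}$ be a finite non-empty set of agents, $\mathrm{Act}$ a finite set of at least two actions, and $\mathrm{AP}$ a countable non-empty set of atomic propositions. Let $\mathsf{ATLD}$, $\mathsf{ATLD}^+$ and $\mathsf{ATLD}^-$ be the languages defined in the context, interpreted over concurrent game structures for $\mathrm{Ag}$, $\mathrm{Act}$, $\mathrm{AP}$. Then $\mathsf{ATLD}^+$ and $\mathsf{ATLD}^-$ are incomparable, $\mathsf{ATLD}^+\prec\mathsf{ATLD}$, and $\mathsf{ATLD}^-\prec\mathsf{ATLD}$.
   Context: **Syntax.** Formulas of $\mathsf{ATLD}$ are given by $\varphi ::= p \mid \neg\varphi \mid (\varphi\lor\varphi) \mid \langle\langle A\rangle\rangle \mathbf{X}\varphi \mid \langle\langle A\rangle\rangle \varphi\,\mathbf{U}\,\varphi \mid \langle\langle A\rangle\rangle \varphi\,\mathbf{R}\,\varphi \mid [\pi]^+\varphi \mid [\pi]^-\varphi \mid has(a,\alpha)$ and $\pi ::= \varphi:\alpha\to A \mid \pi,\pi$, where $p\in\mathrm{AP}$, $\alpha\in\mathrm{Act}$, $a\in\mathrm{Ag}$, $A\subseteq\mathrm{Ag}$. So an update $\pi$ is a non-empty finite list $\varphi_1:\alpha_1\to A_1,\dots,\varphi_k:\alpha_k\to A_k$. $\mathsf{ATLD}^+$ is the fragment without $[\pi]^-$, and $\mathsf{ATLD}^-$ is the fragment without $[\pi]^+$ (both keep $has$). **Models.** A concurrent game structure (CGS) is $\mathcal G=(V,\ell,d,o)$ with $V$ a finite (non-empty)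 set of states, $\ell:V\to 2^{\mathrm{AP}}$ a labelling, $d:\mathrm{Ag}\times V\to 2^{\mathrm{Act}}\setminus\{\emptyset\}$ an availability function, and $o:V\times\mathrm{Act}^{\mathrm{Ag}}\to V$ a transition function (total, defined also on joint actions that contain unavailable actions). A path is an infinite sequence $\lambda=\lambda_0\lambda_1\dots$ of states such that for each $i$ there is $\mathbf c\in\prod_{a\in \mathrm{Ag}} d(a,\lambda_i)$ with $o(\lambda_i,\mathbf c)=\lambda_{i+1}$. A memoryless strategy of $a$ is $\sigma_a:V\to\mathrm{Act}$ with $\sigma_a(v)\in d(a,v)$ for all $v$. A strategy profile $\sigma_A$ of $A\subseteq\mathrm{Ag}$ consists of one strategy for each $a\in A$. $\mathrm{out}(v,\sigma_A)$ is the set of paths $\lambda$ with $\lambda_0=v$ such that for each $i$ there is $\mathbf c\in\prod_{a\in \mathrm{Ag}} d(a,\lambda_i)$ with $\mathbf c_a=\sigma_a(\lambda_i)$ for all $a\in A$ and $o(\lambda_i,\mathbf c)=\lambda_{i+1}$. **Semantics.** $\mathcal G,v\models p$ iff $p\in\ell(v)$; Boolean connectives as usual. $\mathcal G,v\models\langle\langle A\rangle\rangle\mathbf X\varphi$ iff there is $\sigma_A$ such that for all $\lambda\in\mathrm{out}(v,\sigma_A)$: $\mathcal G,\lambda_1\models\varphi$. $\mathcal G,v\models\langle\langle A\rangle\rangle\varphi\,\mathbf U\,\psi$ iff there is $\sigma_A$ such that for all $\lambda\in\mathrm{out}(v,\sigma_A)$ there is $i\ge 0$ with $\mathcal G,\lambda_i\models\psi$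 and $\mathcal G,\lambda_j\models\varphi$ for all $0\le j<i$. $\mathcal G,v\models\langle\langle A\rangle\rangle\varphi\,\mathbf R\,\psi$ iff there is $\sigma_A$ such that for all $\lambda\in\mathrm{out}(v,\sigma_A)$ and all $k\ge0$: $\mathcal G,\lambda_k\models\psi$ or there is $0\le j<k$ with $\mathcal G,\lambda_j\models\varphi$. $\mathcal G,v\models has(a,\alpha)$ iff $\alpha\in d(a,v)$. For $\pi=\varphi_1:\alpha_1\to A_1,\dots,\varphi_k:\alpha_k\to A_k$ put $upd^\pi(a,v')=\{\alpha_i\mid 1\le i\le k,\ \mathcal G,v'\models\varphi_i,\ a\in A_i\}$. $\mathcal G,v\models[\pi]^+\psi$ iff $(V,\ell,d',o),v\models\psi$ where $d'(a,v')=d(a,v')\cup upd^\pi(a,v')$ for all $a,v'$. $\mathcal G,v\models[\pi]^-\psi$ iff $(V,\ell,d',o),v\models\psi$ where for all $a,v'$, $d'(a,v')=d(a,v')\setminus upd^\pi(a,v')$ if $d(a,v')\not\subseteq upd^\pi(a,v')$, and $d'(a,v')=d(a,v')$ otherwise. **Expressivity.** Formulas $\varphi,\psi$ are equivalent if for every CGS $\mathcal G$ and state $v$: $\mathcal G,v\models\varphi$ iff $\mathcal G,v\models\psi$. $\mathsf L_1\preccurlyeq\mathsf L_2$ means every formula of $\mathsf L_1$ has an equivalent formula in $\mathsf L_2$. $\mathsf L_1\prec\mathsf L_2$ means $\mathsf L_1\preccurlyeq\mathsf L_2$ and $\mathsf L_2\not\preccurlyeq\mathsf L_1$. $\mathsf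 L_1$ and $\mathsf L_2$ are incomparable if $\mathsf L_1\not\preccurlyeq\mathsf L_2$ and $\mathsf L_2\not\preccurlyeq\mathsf L_1$. *)

theory Defs
  imports Complex_Main "HOL-Library.Countable"
begin

text \<open>
  Agents, actions and atomic propositions are the elements of the types \<open>'ag\<close>, \<open>'act\<close> and \<open>'ap\<close>.
  An \<open>update\<close> is a non-empty list of clauses \<open>\<phi> : \<alpha> \<rightarrow> A\<close>. \<open>Grant \<pi> \<psi>\<close> stands for the formula
  \<open>[\<pi>]\<close>-plus \<open>\<psi>\<close>, and \<open>Revoke \<pi> \<psi>\<close> for \<open>[\<pi>]\<close>-minus \<open>\<psi>\<close>.
\<close>

datatype ('ap, 'act, 'ag) fm =
    Atom 'ap
  | Neg "('ap, 'act, 'ag) fm"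
  | Disj "('ap, 'act, 'ag) fm" "('ap, 'act, 'ag) fm"
  | CanNext "'ag set" "('ap, 'act, 'ag) fm"
  | CanUntil "'ag set" "('ap, 'act, 'ag) fm" "('ap, 'act, 'ag) fm"
  | CanRelease "'ag set" "('ap, 'act, 'ag) fm" "('ap, 'act, 'ag) fm"
  | Grant "('ap, 'act, 'ag) update" "('ap, 'act, 'ag) fm"
  | Revoke "('ap, 'act, 'ag) update" "('ap, 'act, 'ag) fm"
  | Has 'ag 'act
and ('ap, 'act, 'ag) update =
    Clause "('ap, 'act, 'ag) fm" 'act "'ag set"
  | ClauseCons "('ap, 'act, 'ag) fm" 'act "'ag set" "('ap, 'act, 'ag) update"

primrec revoke_free :: "('ap, 'act, 'ag) fm \<Rightarrow> bool"
  and revoke_free_update :: "('ap, 'act, 'ag) update \<Rightarrow> bool" where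
  "revoke_free (Atom p) \<longleftrightarrow> True"
| "revoke_free (Neg \<phi>) \<longleftrightarrow> revoke_free \<phi>"
| "revoke_free (Disj \<phi> \<psi>) \<longleftrightarrow> revoke_free \<phi> \<and> revoke_free \<psi>"
| "revoke_free (CanNext A \<phi>) \<longleftrightarrow> revoke_free \<phi>"
| "revoke_free (CanUntil A \<phi> \<psi>) \<longleftrightarrow> revoke_free \<phi> \<and> revoke_free \<psi>"
| "revoke_free (CanRelease A \<phi> \<psi>) \<longleftrightarrow> revoke_free \<phi> \<and> revoke_free \<psi>"
| "revoke_free (Grant \<pi> \<psi>) \<longleftrightarrow> revoke_free_update \<pi> \<and> revoke_free \<psi>"
| "revoke_free (Revoke \<pi> \<psi>) \<longleftrightarrow> False"
| "revoke_free (Has a \<alpha>) \<longleftrightarrow> True"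
| "revoke_free_update (Clause \<phi> \<alpha> A) \<longleftrightarrow> revoke_free \<phi>"
| "revoke_free_update (ClauseCons \<phi> \<alpha> A \<pi>) \<longleftrightarrow> revoke_free \<phi> \<and> revoke_free_update \<pi>"

primrec grant_free :: "('ap, 'act, 'ag) fm \<Rightarrow> bool"
  and grant_free_update :: "('ap, 'act, 'ag) update \<Rightarrow> bool" where
  "grant_free (Atom p) \<longleftrightarrow> True"
| "grant_free (Neg \<phi>) \<longleftrightarrow> grant_free \<phi>"
| "grant_free (Disj \<phi> \<psi>) \<longleftrightarrow> grant_free \<phi> \<and> grant_free \<psi>"
| "grant_free (CanNext A \<phi>) \<longleftrightarrow> grant_free \<phi>"
| "grant_free (CanUntil A \<phi> \<psi>) \<longleftrightarrow> grant_free \<phi> \<and> grant_free \<psi>"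
| "grant_free (CanRelease A \<phi> \<psi>) \<longleftrightarrow> grant_free \<phi> \<and> grant_free \<psi>"
| "grant_free (Grant \<pi> \<psi>) \<longleftrightarrow> False"
| "grant_free (Revoke \<pi> \<psi>) \<longleftrightarrow> grant_free_update \<pi> \<and> grant_free \<psi>"
| "grant_free (Has a \<alpha>) \<longleftrightarrow> True"
| "grant_free_update (Clause \<phi> \<alpha> A) \<longleftrightarrow> grant_free \<phi>"
| "grant_free_update (ClauseCons \<phi> \<alpha> A \<pi>) \<longleftrightarrow> grant_free \<phi> \<and> grant_free_update \<pi>"

definition ATLD :: "('ap, 'act, 'ag) fm set" where
  "ATLD = UNIV"

definition ATLD_plus :: "('ap, 'act, 'ag) fm set" where
  "ATLD_plus = {\<phi>. revoke_free \<phi>}"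

definition ATLD_minus :: "('ap, 'act, 'ag) fm set" where
  "ATLD_minus = {\<phi>. grant_free \<phi>}"

text \<open>
  The states of a structure form a subset \<open>states G\<close> of the type \<open>'s\<close>; the values of the other
  components at elements outside \<open>states G\<close> are irrelevant.
\<close>

record ('s, 'ap, 'act, 'ag) cgs =
  states :: "'s set"
  labels :: "'s \<Rightarrow> 'ap set"
  avail :: "'ag \<Rightarrow> 's \<Rightarrow> 'act set"
  outcome :: "'s \<Rightarrow> ('ag \<Rightarrow> 'act) \<Rightarrow> 's"

definition is_cgs :: "('s, 'ap, 'act, 'ag) cgs \<Rightarrow> bool" where
  "is_cgs G \<longleftrightarrow> finite (states G) \<and> states G \<noteq> {} \<and>
     (\<forall>a. \<forall>v\<in>states G. avail G a v \<noteq> {}) \<and>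
     (\<forall>v\<in>states G. \<forall>c. outcome G v c \<in> states G)"

definition paths :: "('s, 'ap, 'act, 'ag) cgs \<Rightarrow> (nat \<Rightarrow> 's) set" where
  "paths G = {\<omega>. \<forall>i. \<omega> i \<in> states G \<and>
     (\<exists>c. (\<forall>a. c a \<in> avail G a (\<omega> i)) \<and> outcome G (\<omega> i) c = \<omega> (Suc i))}"

text \<open>A strategy profile of \<open>A\<close> is given by a map on all agents; its values outside \<open>A\<close> are unused.\<close>

definition strategy_profile ::
  "('s, 'ap, 'act, 'ag) cgs \<Rightarrow> 'ag set \<Rightarrow> ('ag \<Rightarrow> 's \<Rightarrow> 'act) \<Rightarrow> bool" where
  "strategy_profile G A \<sigma> \<longleftrightarrow> (\<forall>a\<in>A. \<forall>v\<in>states G. \<sigma> a v \<in> avail G a v)"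

definition out ::
  "('s, 'ap, 'act, 'ag) cgs \<Rightarrow> 'ag set \<Rightarrow> 's \<Rightarrow> ('ag \<Rightarrow> 's \<Rightarrow> 'act) \<Rightarrow> (nat \<Rightarrow> 's) set" where
  "out G A v \<sigma> = {\<omega> \<in> paths G. \<omega> 0 = v \<and>
     (\<forall>i. \<exists>c. (\<forall>a. c a \<in> avail G a (\<omega> i)) \<and> (\<forall>a\<in>A. c a = \<sigma> a (\<omega> i)) \<and>
              outcome G (\<omega> i) c = \<omega> (Suc i))}"

definition enforces ::
  "('s, 'ap, 'act, 'ag) cgs \<Rightarrow> 'ag set \<Rightarrow> 's \<Rightarrow> ((nat \<Rightarrow> 's) \<Rightarrow> bool) \<Rightarrow> bool" where
  "enforces G A v T \<longleftrightarrow> (\<exists>\<sigma>. strategy_profile G A \<sigma> \<and> (\<forall>\<omega>\<in>out G A v \<sigma>. T \<omega>))"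

definition grant_avail ::
  "('s, 'ap, 'act, 'ag) cgs \<Rightarrow> ('ag \<Rightarrow> 's \<Rightarrow> 'act set) \<Rightarrow> ('s, 'ap, 'act, 'ag) cgs" where
  "grant_avail G u = G\<lparr>avail := \<lambda>a v. avail G a v \<union> u a v\<rparr>"

definition revoke_avail ::
  "('s, 'ap, 'act, 'ag) cgs \<Rightarrow> ('ag \<Rightarrow> 's \<Rightarrow> 'act set) \<Rightarrow> ('s, 'ap, 'act, 'ag) cgs" where
  "revoke_avail G u =
     G\<lparr>avail := \<lambda>a v. if avail G a v \<subseteq> u a v then avail G a v else avail G a v - u a v\<rparr>"

primrec sat :: "('s, 'ap, 'act, 'ag) cgs \<Rightarrow> 's \<Rightarrow> ('ap, 'act, 'ag) fm \<Rightarrow> bool"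
  and upd :: "('s, 'ap, 'act, 'ag) cgs \<Rightarrow> ('ap, 'act, 'ag) update \<Rightarrow> 'ag \<Rightarrow> 's \<Rightarrow> 'act set" where
  "sat G v (Atom p) \<longleftrightarrow> p \<in> labels G v"
| "sat G v (Neg \<phi>) \<longleftrightarrow> \<not> sat G v \<phi>"
| "sat G v (Disj \<phi> \<psi>) \<longleftrightarrow> sat G v \<phi> \<or> sat G v \<psi>"
| "sat G v (CanNext A \<phi>) \<longleftrightarrow> enforces G A v (\<lambda>\<omega>. sat G (\<omega> 1) \<phi>)"
| "sat G v (CanUntil A \<phi> \<psi>) \<longleftrightarrow>
     enforces G A v (\<lambda>\<omega>. \<exists>i. sat G (\<omega> i) \<psi> \<and> (\<forall>j<i. sat G (\<omega> j) \<phi>))"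
| "sat G v (CanRelease A \<phi> \<psi>) \<longleftrightarrow>
     enforces G A v (\<lambda>\<omega>. \<forall>k. sat G (\<omega> k) \<psi> \<or> (\<exists>j<k. sat G (\<omega> j) \<phi>))"
| "sat G v (Grant \<pi> \<psi>) \<longleftrightarrow> sat (grant_avail G (upd G \<pi>)) v \<psi>"
| "sat G v (Revoke \<pi> \<psi>) \<longleftrightarrow> sat (revoke_avail G (upd G \<pi>)) v \<psi>"
| "sat G v (Has a \<alpha>) \<longleftrightarrow> \<alpha> \<in> avail G a v"
| "upd G (Clause \<phi> \<alpha> A) = (\<lambda>a v. {\<beta>. \<beta> = \<alpha> \<and> sat G v \<phi> \<and> a \<in> A})"
| "upd G (ClauseCons \<phi> \<alpha> A \<pi>) = (\<lambda>a v. {\<beta>. \<beta> = \<alpha> \<and> sat G v \<phi> \<and> a \<in> A} \<union> upd G \<pi> a v)"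

text \<open>
  HOL cannot quantify over state types inside a formula, so equivalence ranges over the structures
  whose states are natural numbers. Up to isomorphism these are all finite structures; the lemma
  \<open>equivalent_any_states\<close> below transfers equivalence to structures over an arbitrary state type.
\<close>

definition equivalent :: "('ap, 'act, 'ag) fm \<Rightarrow> ('ap, 'act, 'ag) fm \<Rightarrow> bool" where
  "equivalent \<phi> \<psi> \<longleftrightarrow>
     (\<forall>G :: (nat, 'ap, 'act, 'ag) cgs. is_cgs G \<longrightarrow>
        (\<forall>v\<in>states G. sat G v \<phi> \<longleftrightarrow> sat G v \<psi>))"

definition at_most_as_expressive ::
  "('ap, 'act, 'ag) fm set \<Rightarrow> ('ap, 'act, 'ag) fm set \<Rightarrow> bool" (infix "\<preceq>\<^sub>e" 50) where
  "L1 \<preceq>\<^sub>e L2 \<longleftrightarrow> (\<forall>\<phi>\<in>L1. \<exists>\<psi>\<in>L2. equivalent \<phi> \<psi>)"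

definition less_expressive ::
  "('ap, 'act, 'ag) fm set \<Rightarrow> ('ap, 'act, 'ag) fm set \<Rightarrow> bool" (infix "\<prec>\<^sub>e" 50) where
  "L1 \<prec>\<^sub>e L2 \<longleftrightarrow> L1 \<preceq>\<^sub>e L2 \<and> \<not> L2 \<preceq>\<^sub>e L1"

definition incomparable ::
  "('ap, 'act, 'ag) fm set \<Rightarrow> ('ap, 'act, 'ag) fm set \<Rightarrow> bool" where
  "incomparable L1 L2 \<longleftrightarrow> \<not> L1 \<preceq>\<^sub>e L2 \<and> \<not> L2 \<preceq>\<^sub>e L1"

primrec clauses :: "('ap, 'act, 'ag) update \<Rightarrow> (('ap, 'act, 'ag) fm \<times> 'act \<times> 'ag set) list" where
  "clauses (Clause \<phi> \<alpha> A) = [(\<phi>, \<alpha>, A)]"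
| "clauses (ClauseCons \<phi> \<alpha> A \<pi>) = (\<phi>, \<alpha>, A) # clauses \<pi>"

lemma upd_eq: "upd G \<pi> a v = {\<alpha>. \<exists>\<phi> A. (\<phi>, \<alpha>, A) \<in> set (clauses \<pi>) \<and> sat G v \<phi> \<and> a \<in> A}"
  by (induction \<pi> rule: update.induct[where ?P1.0 = "\<lambda>_. True"]) auto

lemma is_cgs_grant_avail: "is_cgs G \<Longrightarrow> is_cgs (grant_avail G u)"
  by (auto simp: is_cgs_def grant_avail_def)

lemma is_cgs_revoke_avail: "is_cgs G \<Longrightarrow> is_cgs (revoke_avail G u)"
  by (auto simp: is_cgs_def revoke_avail_def)

definition cgs_iso ::
  "('s \<Rightarrow> 't) \<Rightarrow> ('s, 'ap, 'act, 'ag) cgs \<Rightarrow> ('t, 'ap, 'act, 'ag) cgs \<Rightarrow> bool" where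
  "cgs_iso f G H \<longleftrightarrow> bij_betw f (states G) (states H) \<and>
     (\<forall>v\<in>states G. labels H (f v) = labels G v \<and> (\<forall>a. avail H a (f v) = avail G a v) \<and>
        (\<forall>c. outcome G v c \<in> states G \<and> outcome H (f v) c = f (outcome G v c)))"

lemma cgs_iso_sym:
  assumes "cgs_iso f G H"
  shows "cgs_iso (inv_into (states G) f) H G"
proof -
  let ?g = "inv_into (states G) f"
  have bij: "bij_betw f (states G) (states H)"
    using assms by (simp add: cgs_iso_def)
  have g: "?g w \<in> states G" "f (?g w) = w" if "w \<in> states H" for w
    using bij that by (auto simp: bij_betw_def inv_into_into f_inv_into_f)
  have fH: "f v \<in> states H" if "v \<in> states G" for v
    using bij that by (auto simp: bij_betw_def)
  have gf: "?g (f v) = v" if "v \<in> states G" for v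
    using bij that by (auto simp: bij_betw_def)
  have "labels G (?g w) = labels H w \<and> (\<forall>a. avail G a (?g w) = avail H a w) \<and>
        (\<forall>c. outcome H w c \<in> states H \<and> outcome G (?g w) c = ?g (outcome H w c))"
    if "w \<in> states H" for w
    using assms g[OF that] unfolding cgs_iso_def by (metis fH gf)
  then show ?thesis
    using bij_betw_inv_into[OF bij] by (simp add: cgs_iso_def)
qed

lemma enforces_iso_imp:
  assumes iso: "cgs_iso f G H" and v: "v \<in> states G"
    and TU: "\<And>\<omega>. range \<omega> \<subseteq> states G \<Longrightarrow> T \<omega> \<longleftrightarrow> U (f \<circ> \<omega>)"
    and G: "enforces G A v T"
  shows "enforces H A (f v) U"
proof -
  let ?g = "inv_into (states G) f"
  have bij: "bij_betw f (states G) (states H)"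
    using iso by (simp add: cgs_iso_def)
  have g: "?g w \<in> states G" "f (?g w) = w" if "w \<in> states H" for w
    using bij that by (auto simp: bij_betw_def inv_into_into f_inv_into_f)
  have gf: "?g (f u) = u" if "u \<in> states G" for u
    using bij that by (auto simp: bij_betw_def)
  have iso': "cgs_iso ?g H G" by (rule cgs_iso_sym[OF iso])
  have av: "avail G a (?g w) = avail H a w" "outcome G (?g w) c = ?g (outcome H w c)"
    if "w \<in> states H" for w a c
    using iso' that by (auto simp: cgs_iso_def)
  obtain \<sigma> where \<sigma>: "strategy_profile G A \<sigma>" "\<forall>\<omega>\<in>out G A v \<sigma>. T \<omega>"
    using G by (auto simp: enforces_def)
  define \<tau> where "\<tau> = (\<lambda>a w. \<sigma> a (?g w))"
  have "strategy_profile H A \<tau>"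
    unfolding strategy_profile_def
  proof (intro ballI)
    fix a w assume "a \<in> A" "w \<in> states H"
    then show "\<tau> a w \<in> avail H a w"
      using \<sigma>(1) g(1)[of w] av(1)[of w a] unfolding strategy_profile_def \<tau>_def by metis
  qed
  moreover have "U \<omega>" if \<omega>: "\<omega> \<in> out H A (f v) \<tau>" for \<omega>
  proof -
    have inH: "\<omega> i \<in> states H" for i
      using \<omega> by (auto simp: out_def paths_def)
    have "\<exists>c. (\<forall>a. c a \<in> avail G a (?g (\<omega> i))) \<and> (\<forall>a\<in>A. c a = \<sigma> a (?g (\<omega> i))) \<and>
           outcome G (?g (\<omega> i)) c = ?g (\<omega> (Suc i))" for i
    proof -
      obtain c where "\<forall>a. c a \<in> avail H a (\<omega> i)" "\<forall>a\<in>A. c a = \<tau> a (\<omega> i)"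
        "outcome H (\<omega> i) c = \<omega> (Suc i)"
        using \<omega> by (fastforce simp: out_def)
      then show ?thesis
        using av[OF inH] by (intro exI[of _ c]) (auto simp: \<tau>_def)
    qed
    moreover have "?g (\<omega> 0) = v"
      using \<omega> gf[OF v] by (auto simp: out_def)
    ultimately have "?g \<circ> \<omega> \<in> out G A v \<sigma>"
      unfolding out_def paths_def using g(1)[OF inH] by fastforce
    then have "T (?g \<circ> \<omega>)" using \<sigma>(2) by blast
    moreover have "f \<circ> (?g \<circ> \<omega>) = \<omega>" using g(2)[OF inH] by (auto simp: fun_eq_iff)
    ultimately show "U \<omega>" using TU[of "?g \<circ> \<omega>"] g(1)[OF inH] by (auto simp: image_subset_iff)
  qed
  ultimately show ?thesis by (auto simp: enforces_def)
qed

lemma enforces_iso: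
  assumes iso: "cgs_iso f G H" and v: "v \<in> states G"
    and TU: "\<And>\<omega>. range \<omega> \<subseteq> states G \<Longrightarrow> T \<omega> \<longleftrightarrow> U (f \<circ> \<omega>)"
  shows "enforces G A v T \<longleftrightarrow> enforces H A (f v) U"
proof
  assume G: "enforces G A v T"
  show "enforces H A (f v) U" by (rule enforces_iso_imp[where T = T and U = U, OF iso v TU G])
next
  assume H: "enforces H A (f v) U"
  let ?g = "inv_into (states G) f"
  have bij: "bij_betw f (states G) (states H)"
    using iso by (simp add: cgs_iso_def)
  have g: "?g w \<in> states G" "f (?g w) = w" if "w \<in> states H" for w
    using bij that by (auto simp: bij_betw_def inv_into_into f_inv_into_f)
  have fv: "f v \<in> states H" "?g (f v) = v"
    using bij v by (auto simp: bij_betw_def)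
  have "U \<omega> \<longleftrightarrow> T (?g \<circ> \<omega>)" if "range \<omega> \<subseteq> states H" for \<omega>
  proof -
    have "f \<circ> (?g \<circ> \<omega>) = \<omega>" "range (?g \<circ> \<omega>) \<subseteq> states G"
      using that g by (auto simp: fun_eq_iff image_subset_iff)
    then show ?thesis using TU[of "?g \<circ> \<omega>"] by simp
  qed
  from enforces_iso_imp[where T = U and U = T, OF cgs_iso_sym[OF iso] fv(1) this H]
  show "enforces G A v T" using fv(2) by simp
qed

lemma sat_iso:
  fixes G :: "('s, 'ap, 'act, 'ag) cgs" and H :: "('t, 'ap, 'act, 'ag) cgs"
  shows "cgs_iso f G H \<Longrightarrow> v \<in> states G \<Longrightarrow> sat G v \<phi> \<longleftrightarrow> sat H (f v) \<phi>"
    and "cgs_iso f G H \<Longrightarrow> v \<in> states G \<Longrightarrow> upd G \<pi> a v = upd H \<pi> a (f v)"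
proof (induction \<phi> and \<pi> arbitrary: G H v and G H v a)
  case (Atom p)
  then show ?case by (simp add: cgs_iso_def)
next
  case (CanNext A \<phi>)
  show ?case unfolding sat.simps
    by (rule enforces_iso[OF CanNext.prems]) (use CanNext in \<open>auto simp: image_subset_iff\<close>)
next
  case (CanUntil A \<phi> \<psi>)
  show ?case unfolding sat.simps
    by (rule enforces_iso[OF CanUntil.prems]) (use CanUntil in \<open>auto simp: image_subset_iff\<close>)
next
  case (CanRelease A \<phi> \<psi>)
  show ?case unfolding sat.simps
    by (rule enforces_iso[OF CanRelease.prems]) (use CanRelease in \<open>auto simp: image_subset_iff\<close>)
next
  case (Grant \<pi> \<psi>)
  have "cgs_iso f (grant_avail G (upd G \<pi>)) (grant_avail H (upd H \<pi>))"
    using Grant.prems(1) Grant.IH(1)[OF Grant.prems(1)] by (simp add: cgs_iso_def grant_avail_def)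
  from Grant.IH(2)[OF this] Grant.prems(2) show ?case by (simp add: grant_avail_def)
next
  case (Revoke \<pi> \<psi>)
  have "cgs_iso f (revoke_avail G (upd G \<pi>)) (revoke_avail H (upd H \<pi>))"
    using Revoke.prems(1) Revoke.IH(1)[OF Revoke.prems(1)]
    by (simp add: cgs_iso_def revoke_avail_def)
  from Revoke.IH(2)[OF this] Revoke.prems(2) show ?case by (simp add: revoke_avail_def)
next
  case (Has a \<alpha>)
  then show ?case by (simp add: cgs_iso_def)
qed auto

lemma equivalent_any_states:
  fixes G :: "('s, 'ap, 'act, 'ag) cgs"
  assumes eq: "equivalent \<phi> \<psi>" and G: "is_cgs G" and v: "v \<in> states G"
  shows "sat G v \<phi> \<longleftrightarrow> sat G v \<psi>"
proof -
  obtain f :: "'s \<Rightarrow> nat" where f: "inj_on f (states G)"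
    using G finite_imp_inj_to_nat_seg unfolding is_cgs_def by metis
  let ?g = "inv_into (states G) f"
  define H where "H = \<lparr>states = f ` states G, labels = \<lambda>w. labels G (?g w),
    avail = \<lambda>a w. avail G a (?g w), outcome = \<lambda>w c. f (outcome G (?g w) c)\<rparr>"
  have iso: "cgs_iso f G H"
    using f G by (auto simp: cgs_iso_def H_def bij_betw_def is_cgs_def)
  have H: "is_cgs H"
    using f G by (auto simp: H_def is_cgs_def)
  have "f v \<in> states H" using v by (simp add: H_def)
  then have "sat H (f v) \<phi> \<longleftrightarrow> sat H (f v) \<psi>"
    using eq H unfolding equivalent_def by blast
  then show ?thesis using sat_iso(1)[OF iso v] by simp
qed

end

theory Submission
  imports Defs
begin

text \<open>
  Grant-free formulas only ever shrink the sets of available actions, so they cannot see what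
  unavailable joint actions would do, whereas a grant followed by a next-step formula can.
  Conversely, if all actions are available then grants have no effect and revoke-free formulas are
  invariant under permuting the action names, whereas revoking a single named action tells apart
  two structures that differ by such a permutation.
\<close>

section \<open>Structures that differ by a renaming of actions\<close>

definition renames ::
  "('act \<Rightarrow> 'act) \<Rightarrow> ('s, 'ap, 'act, 'ag) cgs \<Rightarrow> ('s, 'ap, 'act, 'ag) cgs \<Rightarrow> bool" where
  "renames \<rho> G H \<longleftrightarrow> bij \<rho> \<and> states H = states G \<and> labels H = labels G \<and>
     (\<forall>a v. avail H a v = \<rho> ` avail G a v) \<and>
     (\<forall>v c. (\<forall>a. c a \<in> avail G a v) \<longrightarrow> outcome H v (\<lambda>a. \<rho> (c a)) = outcome G v c)"

lemma renames_inv: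
  assumes "renames \<rho> G H"
  shows "renames (inv \<rho>) H G"
proof -
  have \<rho>: "bij \<rho>" and av: "\<And>a v. avail H a v = \<rho> ` avail G a v"
    and ou: "\<And>v c. (\<forall>a. c a \<in> avail G a v) \<Longrightarrow> outcome H v (\<lambda>a. \<rho> (c a)) = outcome G v c"
    using assms by (auto simp: renames_def)
  have "outcome G v (\<lambda>a. inv \<rho> (c a)) = outcome H v c" if "\<forall>a. c a \<in> avail H a v" for v c
  proof -
    have "inv \<rho> (c a) \<in> avail G a v" for a
    proof -
      have "c a \<in> \<rho> ` avail G a v"
        using that by (simp add: av)
      then show ?thesis
        using \<rho> by (auto simp: bij_def)
    qed
    from ou[OF allI[OF this]] show ?thesis
      using \<rho> by (simp add: bij_def surj_f_inv_f)
  qed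
  moreover have "avail G a v = inv \<rho> ` avail H a v" for a v
    using \<rho> by (simp add: av bij_def image_inv_f_f)
  ultimately show ?thesis
    using assms \<rho> by (auto simp: renames_def bij_imp_bij_inv)
qed

text \<open>Compose the winning strategy with \<open>\<rho>\<close>. Paths use available joint
  actions only, so each step in \<open>H\<close> pulls back along \<open>\<rho>\<close> to a step in
  \<open>G\<close> between the same states, and no new outcome path arises.\<close>

lemma enforces_renames_imp:
  assumes R: "renames \<rho> G H" and G: "enforces G A v T"
  shows "enforces H A v T"
proof -
  have \<rho>: "inj \<rho>" and st: "states H = states G"
    and av: "\<And>a v. avail H a v = \<rho> ` avail G a v"
    and ou: "\<And>v c. (\<forall>a. c a \<in> avail G a v) \<Longrightarrow> outcome H v (\<lambda>a. \<rho> (c a)) = outcome G v c"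
    using R by (auto simp: renames_def bij_def)
  obtain \<sigma> where \<sigma>: "strategy_profile G A \<sigma>" "\<forall>\<omega>\<in>out G A v \<sigma>. T \<omega>"
    using G by (auto simp: enforces_def)
  let ?\<tau> = "\<lambda>a w. \<rho> (\<sigma> a w)"
  have "strategy_profile H A ?\<tau>"
    using \<sigma>(1) by (auto simp: strategy_profile_def st av)
  moreover have "out H A v ?\<tau> \<subseteq> out G A v \<sigma>"
  proof
    fix \<omega> assume \<omega>: "\<omega> \<in> out H A v ?\<tau>"
    have "\<exists>c. (\<forall>a. c a \<in> avail G a (\<omega> i)) \<and> (\<forall>a\<in>A. c a = \<sigma> a (\<omega> i)) \<and>
        outcome G (\<omega> i) c = \<omega> (Suc i)" for i
    proof -
      obtain c where c: "\<forall>a. c a \<in> avail H a (\<omega> i)" "\<forall>a\<in>A. c a = ?\<tau> a (\<omega> i)"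
        "outcome H (\<omega> i) c = \<omega> (Suc i)"
        using \<omega> by (fastforce simp: out_def)
      have "\<forall>a. \<exists>\<beta>. \<beta> \<in> avail G a (\<omega> i) \<and> c a = \<rho> \<beta>"
        using c(1) by (auto simp: av)
      then obtain e where e: "\<And>a. e a \<in> avail G a (\<omega> i)" "\<And>a. c a = \<rho> (e a)"
        by metis
      have "c = (\<lambda>a. \<rho> (e a))"
        using e(2) by (rule ext)
      then show ?thesis
        \<comment> \<open>Injectivity of \<open>\<rho>\<close> turns
          \<open>\<rho> (e a) = \<rho> (\<sigma> a (\<omega> i))\<close> into agreement of
          \<open>e\<close> with \<open>\<sigma>\<close> on \<open>A\<close>.\<close>
        using c(2,3) e(1) ou[of e "\<omega> i"] \<rho> by (intro exI[of _ e]) (auto simp: inj_eq)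
    qed
    then show "\<omega> \<in> out G A v \<sigma>"
      using \<omega> by (fastforce simp: out_def paths_def st)
  qed
  ultimately show ?thesis
    using \<sigma>(2) by (auto simp: enforces_def)
qed

lemma enforces_renames:
  assumes "renames \<rho> G H"
  shows "enforces G A v T \<longleftrightarrow> enforces H A v T"
  using enforces_renames_imp[OF assms] enforces_renames_imp[OF renames_inv[OF assms]] by blast

section \<open>Invariance of the two fragments\<close>

text \<open>Revoking only shrinks availability, so a joint action available afterwards was available
  before, where the outcomes agree. Granting lacks this property.\<close>

lemma renames_id_revoke_avail:
  assumes "renames id G H"
  shows "renames id (revoke_avail G u) (revoke_avail H u)"
proof -
  have "c a \<in> avail G a v"
    if "c a \<in> (if avail G a v \<subseteq> u a v then avail G a v else avail G a v - u a v)" for c a v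
    using that by (auto split: if_splits)
  then show ?thesis
    using assms by (auto simp: renames_def revoke_avail_def)
qed

text \<open>Simultaneous induction on formulas and updates. \<open>G\<close> and \<open>H\<close>
  stay arbitrary because a revocation replaces both; updates are shown equal as functions, so that
  both structures are revoked by the same \<open>u\<close>.\<close>

lemma grant_free_sat:
  shows "renames id G H \<Longrightarrow> grant_free \<phi> \<Longrightarrow> sat G v \<phi> \<longleftrightarrow> sat H v \<phi>"
    and "renames id G H \<Longrightarrow> grant_free_update \<pi> \<Longrightarrow> upd G \<pi> = upd H \<pi>"
proof (induction \<phi> and \<pi> arbitrary: G H v and G H)
  case (Atom p)
  then show ?case by (simp add: renames_def)
next
  case (CanNext A \<phi>)
  then have "sat G w \<phi> \<longleftrightarrow> sat H w \<phi>" for w by simp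
  then show ?case using enforces_renames[OF CanNext.prems(1)] by simp
next
  case (CanUntil A \<phi> \<psi>)
  then have "sat G w \<phi> \<longleftrightarrow> sat H w \<phi>" "sat G w \<psi> \<longleftrightarrow> sat H w \<psi>" for w by simp_all
  then show ?case using enforces_renames[OF CanUntil.prems(1)] by simp
next
  case (CanRelease A \<phi> \<psi>)
  then have "sat G w \<phi> \<longleftrightarrow> sat H w \<phi>" "sat G w \<psi> \<longleftrightarrow> sat H w \<psi>" for w by simp_all
  then show ?case using enforces_renames[OF CanRelease.prems(1)] by simp
next
  case (Revoke \<pi> \<psi>)
  have "upd G \<pi> = upd H \<pi>"
    using Revoke by simp
  then show ?case
    using Revoke.IH(2)[OF renames_id_revoke_avail[OF Revoke.prems(1)]] Revoke.prems(2) by simp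
next
  case (Has a \<alpha>)
  then show ?case by (simp add: renames_def)
next
  case (Clause \<phi> \<alpha> A)
  then have "sat G v \<phi> \<longleftrightarrow> sat H v \<phi>" for v by auto
  then show ?case by simp
next
  case (ClauseCons \<phi> \<alpha> A \<pi>)
  then have "sat G v \<phi> \<longleftrightarrow> sat H v \<phi>" "upd G \<pi> = upd H \<pi>" for v by auto
  then show ?case by simp
qed simp_all

text \<open>With every action available, a grant leaves both structures unchanged. Hence
  \<open>G\<close> and \<open>H\<close> can stay fixed in the induction, and the trivial predicate
  suffices for updates.\<close>

lemma revoke_free_sat_full:
  assumes R: "renames \<rho> G H" and full: "\<And>a v. avail G a v = UNIV"
  shows "revoke_free \<phi> \<Longrightarrow> sat G v \<phi> \<longleftrightarrow> sat H v \<phi>"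
proof (induction \<phi> arbitrary: v rule: fm.induct[where ?P2.0 = "\<lambda>_. True"])
  case (Grant \<pi> \<psi>)
  \<comment> \<open>Fullness passes to \<open>H\<close> because \<open>\<rho>\<close> is
    surjective.\<close>
  have "avail H a v = UNIV" for a v
    using R full by (auto simp: renames_def bij_def)
  then have "grant_avail H u = H" "grant_avail G u = G" for u
    using full by (auto simp: grant_avail_def fun_eq_iff intro!: cgs.equality)
  then show ?case using Grant by simp
next
  case (Has a \<alpha>)
  then show ?case
    using R full by (auto simp: renames_def bij_def)
next
  case (Atom p)
  then show ?case using R by (simp add: renames_def)
qed (simp_all add: enforces_renames[OF R])

section \<open>The separating structures\<close>

definition gate ::
  "'ap \<Rightarrow> 'ag \<Rightarrow> 'act set \<Rightarrow> 'act set \<Rightarrow> (nat, 'ap, 'act, 'ag) cgs" where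
  "gate p a D P = \<lparr>states = {0, 1}, labels = \<lambda>v. if v = 1 then {p} else {},
     avail = \<lambda>_ _. D, outcome = \<lambda>v c. if c a \<in> P then 1 else 0\<rparr>"

lemma is_cgs_gate: "D \<noteq> {} \<Longrightarrow> is_cgs (gate p a D P)"
  by (auto simp: is_cgs_def gate_def)

text \<open>The empty coalition constrains nobody, so the formula speaks about all available joint
  actions, and \<open>a\<close> can reach state 1 exactly by an action in both \<open>D\<close> and
  \<open>P\<close>.\<close>

lemma sat_gate_CanNext:
  "sat (gate p a D P) 0 (CanNext {} (Neg (Atom p))) \<longleftrightarrow> D \<inter> P = {}"
proof
  assume "D \<inter> P = {}"
  have "\<omega> 1 = 0" if "\<omega> \<in> out (gate p a D P) {} 0 \<sigma>" for \<omega> \<sigma>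
  proof -
    have "\<forall>i. \<exists>c. (\<forall>b. c b \<in> D) \<and> \<omega> (Suc i) = (if c a \<in> P then 1 else 0)"
      using that by (simp add: out_def paths_def gate_def eq_commute[of _ "\<omega> _"])
    then obtain c where "\<forall>b. c b \<in> D" "\<omega> (Suc 0) = (if c a \<in> P then 1 else 0)"
      by blast
    then show ?thesis
      using \<open>D \<inter> P = {}\<close> by (auto split: if_splits)
  qed
  moreover have "\<not> sat (gate p a D P) 0 (Atom p)"
    by (simp add: gate_def)
  ultimately have "\<not> sat (gate p a D P) (\<omega> 1) (Atom p)"
    if "\<omega> \<in> out (gate p a D P) {} 0 \<sigma>" for \<omega> \<sigma>
    using that by metis
  then show "sat (gate p a D P) 0 (CanNext {} (Neg (Atom p)))"
    unfolding sat.simps enforces_def strategy_profile_def by blast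
next
  assume sat: "sat (gate p a D P) 0 (CanNext {} (Neg (Atom p)))"
  show "D \<inter> P = {}"
  proof (rule ccontr)
    assume "D \<inter> P \<noteq> {}"
    then obtain \<gamma> where \<gamma>: "\<gamma> \<in> D" "\<gamma> \<in> P" by blast
    \<comment> \<open>The path on which everyone plays \<open>\<gamma>\<close> forever: it enters
      state 1 at once and stays there.\<close>
    let ?\<omega> = "\<lambda>i::nat. if i = 0 then 0 else 1::nat"
    have "?\<omega> \<in> out (gate p a D P) {} 0 \<sigma>" for \<sigma>
      using \<gamma> by (auto simp: out_def paths_def gate_def intro!: exI[of _ "\<lambda>_. \<gamma>"])
    then show False
      using sat by (fastforce simp: enforces_def gate_def)
  qed
qed

text \<open>The syntax has no truth constant; this tautology is the guard of an unconditional
  update.\<close>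

abbreviation (input) always :: "'ap \<Rightarrow> ('ap, 'act, 'ag) fm" where
  "always p \<equiv> Disj (Atom p) (Neg (Atom p))"

lemma grant_gate:
  "grant_avail (gate p a D P) (upd (gate p a D P) (Clause (always p) \<alpha> UNIV))
     = gate p a (insert \<alpha> D) P"
  by (auto simp: grant_avail_def gate_def)

text \<open>The premise is needed since a revocation that would empty an agent's action set is
  ignored.\<close>

lemma revoke_gate:
  "\<not> D \<subseteq> {\<alpha>} \<Longrightarrow> revoke_avail (gate p a D P) (upd (gate p a D P) (Clause (always p) \<alpha> UNIV))
     = gate p a (D - {\<alpha>}) P"
  by (auto simp: revoke_avail_def gate_def)

lemma grant_not_expressible:
  fixes \<alpha> \<beta> :: 'act and p :: 'ap and a :: 'ag and \<psi> :: "('ap, 'act, 'ag) fm"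
  assumes "\<alpha> \<noteq> \<beta>" and "grant_free \<psi>"
  shows "\<not> equivalent (Grant (Clause (always p) \<alpha> UNIV) (CanNext {} (Neg (Atom p)))) \<psi>"
proof
  let ?\<phi> = "Grant (Clause (always p) \<alpha> (UNIV :: 'ag set)) (CanNext {} (Neg (Atom p)))"
  let ?G = "gate p a {\<beta>} {\<alpha>}" and ?H = "gate p a {\<beta>} {}"
  assume eq: "equivalent ?\<phi> \<psi>"
  have "renames id ?G ?H"
    using assms(1) by (auto simp: renames_def gate_def)
  then have "sat ?G 0 \<psi> \<longleftrightarrow> sat ?H 0 \<psi>"
    by (rule grant_free_sat(1)[OF _ assms(2)])
  moreover have "sat (gate p a {\<beta>} P) 0 ?\<phi> \<longleftrightarrow> sat (gate p a {\<beta>} P) 0 \<psi>" for P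
    using eq is_cgs_gate[of "{\<beta>}" p a P] by (auto simp: equivalent_def gate_def)
  moreover have "sat (gate p a {\<beta>} P) 0 ?\<phi> \<longleftrightarrow> insert \<alpha> {\<beta>} \<inter> P = {}" for P
    by (simp only: sat.simps(7) grant_gate sat_gate_CanNext)
  ultimately show False by auto
qed

text \<open>All actions are available; one gate is opened by \<open>\<alpha>\<close>, the other by
  \<open>\<beta>\<close>. Swapping the two names relates them, but after \<open>\<alpha>\<close> is
  revoked only the second can still be opened.\<close>

lemma revoke_not_expressible:
  fixes \<alpha> \<beta> :: 'act and p :: 'ap and a :: 'ag and \<psi> :: "('ap, 'act, 'ag) fm"
  assumes "\<alpha> \<noteq> \<beta>" and "revoke_free \<psi>"
  shows "\<not> equivalent (Revoke (Clause (always p) \<alpha> UNIV) (CanNext {} (Neg (Atom p)))) \<psi>"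
proof
  let ?\<phi> = "Revoke (Clause (always p) \<alpha> (UNIV :: 'ag set)) (CanNext {} (Neg (Atom p)))"
  let ?G = "gate p a UNIV {\<alpha>}" and ?H = "gate p a UNIV {\<beta>}"
  let ?\<rho> = "id(\<alpha> := \<beta>, \<beta> := \<alpha>)"
  assume eq: "equivalent ?\<phi> \<psi>"
  have \<rho>: "bij ?\<rho>"
    \<comment> \<open>The transposition is its own inverse.\<close>
    by (rule o_bij[of ?\<rho>]) (auto simp: fun_eq_iff)
  have not_sub: "\<not> UNIV \<subseteq> {\<alpha>}"
    using assms(1) by (metis UNIV_I singletonD subsetD)
  have "renames ?\<rho> ?G ?H"
    using \<rho> assms(1) by (auto simp: renames_def gate_def bij_def)
  then have "sat ?G 0 \<psi> \<longleftrightarrow> sat ?H 0 \<psi>"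
    by (rule revoke_free_sat_full[OF _ _ assms(2)]) (simp add: gate_def)
  moreover have "sat (gate p a UNIV P) 0 ?\<phi> \<longleftrightarrow> sat (gate p a UNIV P) 0 \<psi>" for P
    using eq is_cgs_gate[of UNIV p a P] by (auto simp: equivalent_def gate_def)
  moreover have "sat (gate p a UNIV P) 0 ?\<phi> \<longleftrightarrow> (UNIV - {\<alpha>}) \<inter> P = {}" for P
    by (simp only: sat.simps(8) revoke_gate[OF not_sub] sat_gate_CanNext)
  ultimately show False using assms(1) by auto
qed

section \<open>Comparison of the three languages\<close>

lemma at_most_as_expressive_subset: "L1 \<subseteq> L2 \<Longrightarrow> L1 \<preceq>\<^sub>e L2"
  by (auto simp: at_most_as_expressive_def equivalent_def)

lemma at_most_as_expressive_mono: "L2 \<preceq>\<^sub>e L3 \<Longrightarrow> L1 \<subseteq> L2 \<Longrightarrow> L1 \<preceq>\<^sub>e L3"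
  by (auto simp: at_most_as_expressive_def)

theorem corollary1:
  assumes "card (UNIV :: 'act set) \<ge> 2"
  shows "incomparable (ATLD_plus :: ('ap::countable, 'act::finite, 'ag::finite) fm set)
             (ATLD_minus :: ('ap, 'act, 'ag) fm set) \<and>
         (ATLD_plus :: ('ap, 'act, 'ag) fm set) \<prec>\<^sub>e (ATLD :: ('ap, 'act, 'ag) fm set) \<and>
         (ATLD_minus :: ('ap, 'act, 'ag) fm set) \<prec>\<^sub>e (ATLD :: ('ap, 'act, 'ag) fm set)"
proof -
  obtain \<alpha> \<beta> :: 'act where ne: "\<alpha> \<noteq> \<beta>"
  proof -
    have "\<not> is_singleton (UNIV :: 'act set)"
      using assms by (auto simp: is_singleton_altdef)
    then show thesis
      using that by (metis (full_types) is_singletonI' empty_not_UNIV)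
  qed
  let ?u = "\<lambda>p. Clause (always p) \<alpha> (UNIV :: 'ag set)"
  let ?n = "\<lambda>p. CanNext {} (Neg (Atom p))"
  \<comment> \<open>Types are inhabited, so an arbitrary \<open>p\<close> stands for an element of
    the non-empty set of atoms.\<close>
  fix p :: 'ap
  have "\<not> (ATLD_plus :: ('ap, 'act, 'ag) fm set) \<preceq>\<^sub>e ATLD_minus"
  proof
    assume "(ATLD_plus :: ('ap, 'act, 'ag) fm set) \<preceq>\<^sub>e ATLD_minus"
    moreover have "Grant (?u p) (?n p) \<in> ATLD_plus"
      by (simp add: ATLD_plus_def)
    ultimately obtain \<psi> where "\<psi> \<in> ATLD_minus" "equivalent (Grant (?u p) (?n p)) \<psi>"
      unfolding at_most_as_expressive_def by blast
    then show False
      using grant_not_expressible[OF ne, of \<psi> p] by (simp add: ATLD_minus_def)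
  qed
  moreover have "\<not> (ATLD_minus :: ('ap, 'act, 'ag) fm set) \<preceq>\<^sub>e ATLD_plus"
  proof
    assume "(ATLD_minus :: ('ap, 'act, 'ag) fm set) \<preceq>\<^sub>e ATLD_plus"
    moreover have "Revoke (?u p) (?n p) \<in> ATLD_minus"
      by (simp add: ATLD_minus_def)
    ultimately obtain \<psi> where "\<psi> \<in> ATLD_plus" "equivalent (Revoke (?u p) (?n p)) \<psi>"
      unfolding at_most_as_expressive_def by blast
    then show False
      using revoke_not_expressible[OF ne, of \<psi> p] by (simp add: ATLD_plus_def)
  qed
  moreover have "(L :: ('ap, 'act, 'ag) fm set) \<preceq>\<^sub>e ATLD" for L
    by (rule at_most_as_expressive_subset) (simp add: ATLD_def)
  \<comment> \<open>Strictness follows from incomparability: if \<open>ATLD\<close> were expressible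
    in one fragment, so would be the other fragment, as a subset of \<open>ATLD\<close>.\<close>
  moreover have "(L :: ('ap, 'act, 'ag) fm set) \<preceq>\<^sub>e L'" if "ATLD \<preceq>\<^sub>e L'" for L L'
    using that by (rule at_most_as_expressive_mono) (simp add: ATLD_def)
  ultimately show ?thesis
    unfolding incomparable_def less_expressive_def by blast
qed

end
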